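(* Let $\{T_i\}_{i\in I}$ be a $p$-frame associated to $(a_2,\dots,a_n)$ for $X$ with bounds $A,B$. Then a sequence $\{R_i\}_{i\in I}\subseteq X_F^{*}$ is a $p$-frame associated to $(a_2,\dots,a_n)$ for $X$ if and only if there exists a constant $M>0$ such that, for all $x\in X$, $$\sum_{i\in I}\big|T_i(x,a_2,\dots,a_n)-R_i(x,a_2,\dots,a_n)\big|^p\le M\min\Big\{\sum_{i\in I}|T_i(x,a_2,\dots,a_n)|^p,\ \sum_{i\in I}|R_i(x,a_2,\dots,a_n)|^p\Big\}.$$
   Context: Let $\mathbb K\in\{\mathbb R,\mathbb C\}$, $n\ge 2$, $p\in(1,\infty)$, and let $I$ be a countable index set. An $n$-norm on a linear space $X$ over $\mathbb K$ is a map $\|\cdot,\dots,\cdot\|_X:X^n\to\mathbb R$ such that (i) $\|x_1,\dots,x_n\|_X=0$ iff $x_1,\dots,x_n$ are linearly dependent; (ii) it is invariant under permutations of its arguments; (iii) $\|\alpha x_1,x_2,\dots,x_n\|_X=|\alpha|\,\|x_1,\dots,x_n\|_X$ for $\alpha\in\mathbb K$; (iv) $\|x+y,x_2,\dots,x_n\|_X\le\|x,x_2,\dots,x_n\|_X+\|y,x_2,\dots,x_n\|_X$. A sequence $\{x_k\}$ converges to $x$ if $\|x_k-x,x_2,\dots,x_n\|_X\to0$ for all $x_2,\dots,x_n\in X$, and is Cauchy if $\|x_l-x_k,x_2,\dots,x_n\|_X\to0$ as $l,k\to\infty$ for all $x_2,\dots,x_n\in X$; $X$ is an $n$-Banach space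 if every Cauchy sequence converges. $X$ is an $n$-Banach space and $a_2,\dots,a_n\in X$ are fixed. A bounded $b$-linear functional on $X\times\langle a_2\rangle\times\cdots\times\langle a_n\rangle$ ($\langle a_i\rangle$ is the subspace generated by $a_i$) is a map $T$ from this set to $\mathbb K$ with $T(x+y,a_2,\dots,a_n)=T(x,a_2,\dots,a_n)+T(y,a_2,\dots,a_n)$, $T(kx,a_2,\dots,a_n)=kT(x,a_2,\dots,a_n)$ for $x,y\in X$, $k\in\mathbb K$, and for which there is $M>0$ with $|T(x,a_2,\dots,a_n)|\le M\|x,a_2,\dots,a_n\|_X$ for all $x\in X$. $X_F^{*}$ is the space of all of these. A countable family $\{T_i\}_{i\in I}\subseteq X_F^{*}$ is a $p$-frame associated to $(a_2,\dots,a_n)$ for $X$ (with bounds $A,B$) if there are constants $A,B>0$ with $A\|x,a_2,\dots,a_n\|_X^p\le\sum_{i\in I}|T_i(x,a_2,\dots,a_n)|^p\le B\|x,a_2,\dots,a_n\|_X^p$ for all $x\in X$. *)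

theory Defs
  imports "HOL-Analysis.Analysis" "HOL-Library.Multiset" "HOL-Library.FuncSet"
begin

(* Scalars: the type 'k ranges over the class real_normed_field, whose norm is
   multiplicative. Both real and complex are instances, and by the Gelfand-Mazur theorem
   every instance is isometrically isomorphic to one of them; norm is the modulus.
   Elements of X^n are lists of length n, so (x, a_2, ..., a_n) is written x # a with
   a = [a_2, ..., a_n]. *)

(* Linear dependence of a family, not of its underlying set: a list with a repeated entry
   is linearly dependent. *)
definition lin_dependent_list ::
  "('k::real_normed_field \<Rightarrow> 'v::ab_group_add \<Rightarrow> 'v) \<Rightarrow> 'v list \<Rightarrow> bool" where
  "lin_dependent_list scl xs \<longleftrightarrow> \<not> distinct xs \<or> module.dependent scl (set xs)"

lemma lin_dependent_list_iff_coefficients: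
  fixes scl :: "'k::real_normed_field \<Rightarrow> 'v::ab_group_add \<Rightarrow> 'v"
  assumes "vector_space scl"
  shows "lin_dependent_list scl xs \<longleftrightarrow>
    (\<exists>c. (\<exists>i<length xs. c i \<noteq> 0) \<and> (\<Sum>i<length xs. scl (c i) (xs ! i)) = 0)"
proof -
  interpret vector_space scl by fact
  show ?thesis
  proof (cases "distinct xs")
    case False
    then obtain i j where ij: "i < length xs" "j < length xs" "i \<noteq> j" "xs ! i = xs ! j"
      by (auto simp: distinct_conv_nth)
    define c :: "nat \<Rightarrow> 'k" where "c k = (if k = i then 1 else if k = j then - 1 else 0)" for k
    have "(\<Sum>k<length xs. scl (c k) (xs ! k)) = (\<Sum>k\<in>{i, j}. scl (c k) (xs ! k))"
      using ij by (intro sum.mono_neutral_right) (auto simp: c_def)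
    also have "\<dots> = 0" using ij by (simp add: c_def)
    finally show ?thesis using False ij
      by (auto simp: lin_dependent_list_def intro!: exI[of _ c] exI[of _ i]) (simp add: c_def)
  next
    case True
    then have bij: "bij_betw ((!) xs) {..<length xs} (set xs)"
      by (rule bij_betw_nth) auto
    have "dependent (set xs) \<longleftrightarrow>
        (\<exists>u. (\<exists>v\<in>set xs. u v \<noteq> 0) \<and> (\<Sum>v\<in>set xs. scl (u v) v) = 0)"
      by (rule dependent_finite) simp
    also have "\<dots> \<longleftrightarrow>
        (\<exists>c. (\<exists>i<length xs. c i \<noteq> 0) \<and> (\<Sum>i<length xs. scl (c i) (xs ! i)) = 0)"
    proof safe
      fix u v assume u: "v \<in> set xs" "u v \<noteq> 0" "(\<Sum>v\<in>set xs. scl (u v) v) = 0"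
      have "(\<Sum>i<length xs. scl (u (xs ! i)) (xs ! i)) = 0"
        using sum.reindex_bij_betw[OF bij, of "\<lambda>v. scl (u v) v"] u(3) by simp
      moreover have "\<exists>i<length xs. u (xs ! i) \<noteq> 0"
        using u by (auto simp: in_set_conv_nth)
      ultimately show "\<exists>c. (\<exists>i<length xs. c i \<noteq> 0) \<and>
          (\<Sum>i<length xs. scl (c i) (xs ! i)) = 0"
        by (intro exI[of _ "\<lambda>i. u (xs ! i)"]) auto
    next
      fix c i assume c: "i < length xs" "c i \<noteq> (0::'k)"
        "(\<Sum>i<length xs. scl (c i) (xs ! i)) = 0"
      define g where "g = inv_into {..<length xs} ((!) xs)"
      have g: "g (xs ! k) = k" if "k < length xs" for k
        unfolding g_def using bij that by (intro inv_into_f_f) (auto simp: bij_betw_def)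
      have "(\<Sum>i<length xs. scl (c (g (xs ! i))) (xs ! i)) =
          (\<Sum>i<length xs. scl (c i) (xs ! i))"
        by (intro sum.cong) (auto simp: g)
      then have "(\<Sum>v\<in>set xs. scl (c (g v)) v) = 0"
        using sum.reindex_bij_betw[OF bij, of "\<lambda>v. scl (c (g v)) v"] c(3)
        by simp
      then show "\<exists>u. (\<exists>v\<in>set xs. u v \<noteq> 0) \<and> (\<Sum>v\<in>set xs. scl (u v) v) = 0"
        using c g by (intro exI[of _ "\<lambda>v. c (g v)"]) (auto intro!: bexI[of _ "xs ! i"])
    qed
    finally show ?thesis using True by (simp add: lin_dependent_list_def)
  qed
qed

locale n_normed_space = vector_space scl
  for scl :: "'k::real_normed_field \<Rightarrow> 'v::ab_group_add \<Rightarrow> 'v" +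
  fixes n :: nat and nnorm :: "'v list \<Rightarrow> real"
  assumes nnorm_eq_0_iff:
      "length xs = n \<Longrightarrow> nnorm xs = 0 \<longleftrightarrow> lin_dependent_list scl xs"
    and nnorm_permute:
      "length xs = n \<Longrightarrow> mset ys = mset xs \<Longrightarrow> nnorm ys = nnorm xs"
    and nnorm_scale:
      "Suc (length xs) = n \<Longrightarrow> nnorm (scl c x # xs) = norm c * nnorm (x # xs)"
    and nnorm_triangle:
      "Suc (length xs) = n \<Longrightarrow> nnorm ((x + y) # xs) \<le> nnorm (x # xs) + nnorm (y # xs)"

definition n_converges_to ::
  "nat \<Rightarrow> ('v::ab_group_add list \<Rightarrow> real) \<Rightarrow> (nat \<Rightarrow> 'v) \<Rightarrow> 'v \<Rightarrow> bool" where
  "n_converges_to n nnorm s x \<longleftrightarrow>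
    (\<forall>xs. Suc (length xs) = n \<longrightarrow> (\<lambda>k. nnorm ((s k - x) # xs)) \<longlonglongrightarrow> 0)"

definition n_Cauchy ::
  "nat \<Rightarrow> ('v::ab_group_add list \<Rightarrow> real) \<Rightarrow> (nat \<Rightarrow> 'v) \<Rightarrow> bool" where
  "n_Cauchy n nnorm s \<longleftrightarrow>
    (\<forall>xs. Suc (length xs) = n \<longrightarrow>
      ((\<lambda>(l, k). nnorm ((s l - s k) # xs)) \<longlongrightarrow> 0) (sequentially \<times>\<^sub>F sequentially))"

locale n_Banach_space = n_normed_space scl n nnorm
  for scl :: "'k::real_normed_field \<Rightarrow> 'v::ab_group_add \<Rightarrow> 'v"
    and n :: nat and nnorm :: "'v list \<Rightarrow> real" +
  assumes n_complete: "n_Cauchy n nnorm s \<Longrightarrow> \<exists>x. n_converges_to n nnorm s x"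

definition b_domain ::
  "('k::real_normed_field \<Rightarrow> 'v::ab_group_add \<Rightarrow> 'v) \<Rightarrow> 'v list \<Rightarrow> 'v list set" where
  "b_domain scl a =
    {x # b | x b. list_all2 (\<lambda>b\<^sub>i a\<^sub>i. b\<^sub>i \<in> module.span scl {a\<^sub>i}) b a}"

(* The space X_F^* of bounded b-linear functionals. Its elements are maps on b_domain
   (extensional outside it), but the conditions only involve the tuples x # a. *)
definition bounded_b_linear_functionals ::
  "('k::real_normed_field \<Rightarrow> 'v::ab_group_add \<Rightarrow> 'v) \<Rightarrow> ('v list \<Rightarrow> real) \<Rightarrow> 'v list
    \<Rightarrow> ('v list \<Rightarrow> 'k) set" where
  "bounded_b_linear_functionals scl nnorm a =
    {T \<in> b_domain scl a \<rightarrow>\<^sub>E UNIV.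
      (\<forall>x y. T ((x + y) # a) = T (x # a) + T (y # a)) \<and>
      (\<forall>k x. T (scl k x # a) = k * T (x # a)) \<and>
      (\<exists>M>0. \<forall>x. norm (T (x # a)) \<le> M * nnorm (x # a))}"

(* The sum is taken in [0, \<infinity>], so a divergent sum has value \<infinity>
   (an infsum of reals would be 0). *)
definition p_sum :: "real \<Rightarrow> 'i set \<Rightarrow> ('i \<Rightarrow> 'k::real_normed_field) \<Rightarrow> ennreal" where
  "p_sum p I c = (\<Sum>\<^sub>\<infinity>i\<in>I. ennreal (norm (c i) powr p))"

definition p_frame_with_bounds ::
  "('k::real_normed_field \<Rightarrow> 'v::ab_group_add \<Rightarrow> 'v) \<Rightarrow> ('v list \<Rightarrow> real) \<Rightarrow> real \<Rightarrow> 'v list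
    \<Rightarrow> 'i set \<Rightarrow> ('i \<Rightarrow> 'v list \<Rightarrow> 'k) \<Rightarrow> real \<Rightarrow> real \<Rightarrow> bool" where
  "p_frame_with_bounds scl nnorm p a I T A B \<longleftrightarrow>
    countable I \<and> (\<forall>i\<in>I. T i \<in> bounded_b_linear_functionals scl nnorm a) \<and>
    A > 0 \<and> B > 0 \<and>
    (\<forall>x. ennreal (A * nnorm (x # a) powr p) \<le> p_sum p I (\<lambda>i. T i (x # a)) \<and>
         p_sum p I (\<lambda>i. T i (x # a)) \<le> ennreal (B * nnorm (x # a) powr p))"

definition p_frame ::
  "('k::real_normed_field \<Rightarrow> 'v::ab_group_add \<Rightarrow> 'v) \<Rightarrow> ('v list \<Rightarrow> real) \<Rightarrow> real \<Rightarrow> 'v list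
    \<Rightarrow> 'i set \<Rightarrow> ('i \<Rightarrow> 'v list \<Rightarrow> 'k) \<Rightarrow> bool" where
  "p_frame scl nnorm p a I T \<longleftrightarrow> (\<exists>A B. p_frame_with_bounds scl nnorm p a I T A B)"

end

theory Submission
  imports Defs
begin

text \<open>
  Write \<open>S u\<close> for the \<open>p\<close>-sum of a family \<open>u\<close> of scalars. The argument rests on the quasi-triangle
  inequality \<open>S (u - v) \<le> 2 powr p * (S u + S v)\<close> and its variant \<open>S u \<le> 2 powr p * (S (u - v) + S v)\<close>.
  Two frames have comparable \<open>p\<close>-sums, both being comparable to the \<open>p\<close>-th power of the \<open>n\<close>-norm, so
  the first inequality bounds \<open>S (T - R)\<close> by a multiple of \<open>S T\<close> and by a multiple of \<open>S R\<close>. Conversely,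
  if \<open>S (T - R)\<close> is at most \<open>M * min (S T) (S R)\<close>, the second inequality, applied to the pairs
  \<open>(R, T)\<close> and \<open>(T, R)\<close>, makes \<open>S T\<close> and \<open>S R\<close> comparable, and the frame bounds of \<open>T\<close> carry over
  to \<open>R\<close>.

  All sums live in \<open>[0, \<infinity>]\<close>, so no convergence has to be shown beforehand; in particular
  the finiteness of \<open>S R\<close> comes out of the estimates.
\<close>

lemma norm_diff_powr_le:
  fixes x y :: "'a::real_normed_vector"
  assumes "p \<ge> 0"
  shows "norm (x - y) powr p \<le> 2 powr p * (norm x powr p + norm y powr p)"
proof -
  define m where "m = max (norm x) (norm y)"
  have "norm (x - y) \<le> 2 * m"
    using norm_triangle_ineq4[of x y] by (simp add: m_def)
  then have "norm (x - y) powr p \<le> (2 * m) powr p"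
    using assms by (intro powr_mono2) auto
  also have "\<dots> = 2 powr p * m powr p"
    by (simp add: powr_mult m_def)
  also have "m powr p \<le> norm x powr p + norm y powr p"
    by (simp add: m_def max_def)
  finally show ?thesis by simp
qed

lemma p_sum_minus_commute: "p_sum p I (\<lambda>i. u i - v i) = p_sum p I (\<lambda>i. v i - u i)"
  by (simp add: p_sum_def norm_minus_commute)

lemma p_sum_diff_le:
  assumes "p \<ge> 0"
  shows "p_sum p I (\<lambda>i. u i - v i) \<le> ennreal (2 powr p) * (p_sum p I u + p_sum p I v)"
proof -
  let ?c = "ennreal (2 powr p)"
  \<comment> \<open>It suffices to bound finite partial sums. Multiplication on \<open>[0, \<infinity>]\<close> is not jointly
    continuous, so the constant is pulled out of finite sums only.\<close>
  have "(\<Sum>i\<in>F. ennreal (norm (u i - v i) powr p)) \<le> ?c * (p_sum p I u + p_sum p I v)"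
    if F: "finite F" "F \<subseteq> I" for F
  proof -
    have "(\<Sum>i\<in>F. ennreal (norm (u i - v i) powr p))
        \<le> (\<Sum>i\<in>F. ?c * (ennreal (norm (u i) powr p) + ennreal (norm (v i) powr p)))"
    proof (rule sum_mono)
      fix i
      show "ennreal (norm (u i - v i) powr p)
          \<le> ?c * (ennreal (norm (u i) powr p) + ennreal (norm (v i) powr p))"
        using norm_diff_powr_le[OF assms, of "u i" "v i"]
        by (simp flip: ennreal_plus ennreal_mult add: ennreal_leI)
    qed
    also have "\<dots> = ?c * ((\<Sum>i\<in>F. ennreal (norm (u i) powr p)) + (\<Sum>i\<in>F. ennreal (norm (v i) powr p)))"
      by (simp add: sum.distrib flip: sum_distrib_left)
    also have "\<dots> \<le> ?c * (p_sum p I u + p_sum p I v)"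
      unfolding p_sum_def using F
      by (intro mult_left_mono add_mono) (auto simp: nonneg_infsum_complete intro: SUP_upper)
    finally show ?thesis .
  qed
  then show ?thesis
    unfolding p_sum_def[of p I "\<lambda>i. u i - v i"]
    by (subst nonneg_infsum_complete) (auto intro: SUP_least)
qed

corollary p_sum_le_diff:
  assumes "p \<ge> 0"
  shows "p_sum p I u \<le> ennreal (2 powr p) * (p_sum p I (\<lambda>i. u i - v i) + p_sum p I v)"
proof -
  have "p_sum p I (\<lambda>i. - v i) = p_sum p I v"
    by (simp add: p_sum_def)
  then show ?thesis
    using p_sum_diff_le[OF assms, of I "\<lambda>i. u i - v i" "\<lambda>i. - v i"] by simp
qed

lemma p_frame_p_sums_comparable:
  assumes T: "p_frame_with_bounds scl nnorm p a I T A B"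
    and R: "p_frame_with_bounds scl nnorm p a I R C D"
  shows "p_sum p I (\<lambda>i. T i (x # a)) \<le> ennreal (B / C) * p_sum p I (\<lambda>i. R i (x # a))"
proof -
  from T R have pos: "B > 0" "C > 0"
    by (auto simp: p_frame_with_bounds_def)
  have "p_sum p I (\<lambda>i. T i (x # a)) \<le> ennreal (B * nnorm (x # a) powr p)"
    using T by (simp add: p_frame_with_bounds_def)
  also have "\<dots> = ennreal (B / C) * ennreal (C * nnorm (x # a) powr p)"
    using pos by (simp flip: ennreal_mult)
  also have "\<dots> \<le> ennreal (B / C) * p_sum p I (\<lambda>i. R i (x # a))"
    using R by (intro mult_left_mono) (auto simp: p_frame_with_bounds_def)
  finally show ?thesis .
qed

lemma p_sum_diff_le_of_comparable:
  assumes "p \<ge> 0" and "K \<ge> 0" and "p_sum p I v \<le> ennreal K * p_sum p I u"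
  shows "p_sum p I (\<lambda>i. u i - v i) \<le> ennreal (2 powr p * (1 + K)) * p_sum p I u"
proof -
  have "p_sum p I (\<lambda>i. u i - v i) \<le> ennreal (2 powr p) * (p_sum p I u + p_sum p I v)"
    using assms(1) by (rule p_sum_diff_le)
  also have "\<dots> \<le> ennreal (2 powr p) * (p_sum p I u + ennreal K * p_sum p I u)"
    using assms(3) by (intro mult_left_mono add_left_mono) auto
  also have "\<dots> = ennreal (2 powr p * (1 + K)) * p_sum p I u"
    using assms(2) by (simp add: ennreal_mult distrib_right mult.assoc)
  finally show ?thesis .
qed

lemma p_sum_comparable_of_diff_le:
  assumes "p \<ge> 0" and "M \<ge> 0" and "p_sum p I (\<lambda>i. u i - v i) \<le> ennreal M * p_sum p I v"
  shows "p_sum p I u \<le> ennreal (2 powr p * (1 + M)) * p_sum p I v"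
proof -
  have "p_sum p I u \<le> ennreal (2 powr p) * (p_sum p I (\<lambda>i. u i - v i) + p_sum p I v)"
    using assms(1) by (rule p_sum_le_diff)
  also have "\<dots> \<le> ennreal (2 powr p) * (ennreal M * p_sum p I v + p_sum p I v)"
    using assms(3) by (intro mult_left_mono add_right_mono) auto
  also have "\<dots> = ennreal (2 powr p * (1 + M)) * p_sum p I v"
    using assms(2) by (simp add: ennreal_mult distrib_right mult.assoc add.commute)
  finally show ?thesis .
qed

lemma p_frame_of_comparable:
  assumes T: "p_frame_with_bounds scl nnorm p a I T A B"
    and R: "\<forall>i\<in>I. R i \<in> bounded_b_linear_functionals scl nnorm a"
    and K: "K > 0"
    and TR: "\<And>x. p_sum p I (\<lambda>i. T i (x # a)) \<le> ennreal K * p_sum p I (\<lambda>i. R i (x # a))"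
    and RT: "\<And>x. p_sum p I (\<lambda>i. R i (x # a)) \<le> ennreal K * p_sum p I (\<lambda>i. T i (x # a))"
  shows "p_frame_with_bounds scl nnorm p a I R (A / K) (K * B)"
proof -
  from T have pos: "A > 0" "B > 0" and I: "countable I"
    by (auto simp: p_frame_with_bounds_def)
  have "ennreal (A / K * nnorm (x # a) powr p) \<le> p_sum p I (\<lambda>i. R i (x # a))" for x
  proof -
    have "ennreal (A / K * nnorm (x # a) powr p)
        = ennreal (1 / K) * ennreal (A * nnorm (x # a) powr p)"
      using K pos by (simp flip: ennreal_mult)
    also have "\<dots> \<le> ennreal (1 / K) * (ennreal K * p_sum p I (\<lambda>i. R i (x # a)))"
      using T TR[of x]
      by (intro mult_left_mono) (auto simp: p_frame_with_bounds_def intro: order_trans)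
    also have "\<dots> = ennreal (1 / K * K) * p_sum p I (\<lambda>i. R i (x # a))"
      using K by (subst ennreal_mult) (auto simp: mult.assoc)
    also have "\<dots> = p_sum p I (\<lambda>i. R i (x # a))"
      using K by simp
    finally show ?thesis .
  qed
  moreover have "p_sum p I (\<lambda>i. R i (x # a)) \<le> ennreal (K * B * nnorm (x # a) powr p)" for x
  proof -
    have "p_sum p I (\<lambda>i. R i (x # a)) \<le> ennreal K * p_sum p I (\<lambda>i. T i (x # a))"
      by (rule RT)
    also have "\<dots> \<le> ennreal K * ennreal (B * nnorm (x # a) powr p)"
      using T by (intro mult_left_mono) (auto simp: p_frame_with_bounds_def)
    also have "\<dots> = ennreal (K * B * nnorm (x # a) powr p)"
      using K pos by (simp flip: ennreal_mult add: mult.assoc)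
    finally show ?thesis .
  qed
  ultimately show ?thesis
    using K pos I R by (simp add: p_frame_with_bounds_def)
qed

theorem theorem5p3:
  fixes scl :: "'k::real_normed_field \<Rightarrow> 'v::ab_group_add \<Rightarrow> 'v"
    and nnorm :: "'v list \<Rightarrow> real"
    and n :: nat and p A B :: real
    and a :: "'v list"
    and I :: "'i set"
    and T R :: "'i \<Rightarrow> 'v list \<Rightarrow> 'k"
  assumes "n \<ge> 2" and "p > 1"
    and "n_Banach_space scl n nnorm"
    and "length a = n - 1"
    and "countable I"
    and "p_frame_with_bounds scl nnorm p a I T A B"
    and "\<forall>i\<in>I. R i \<in> bounded_b_linear_functionals scl nnorm a"
  shows "p_frame scl nnorm p a I R \<longleftrightarrow>
    (\<exists>M>0. \<forall>x. p_sum p I (\<lambda>i. T i (x # a) - R i (x # a)) \<le>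
       ennreal M * min (p_sum p I (\<lambda>i. T i (x # a))) (p_sum p I (\<lambda>i. R i (x # a))))"
    (is "_ \<longleftrightarrow> (\<exists>M>0. \<forall>x. ?d x \<le> ennreal M * min (?t x) (?r x))")
proof
  have p: "p \<ge> 0" using assms(2) by simp
  note T = assms(6)
  from T have AB: "A > 0" "B > 0"
    by (auto simp: p_frame_with_bounds_def)
  {
    assume "p_frame scl nnorm p a I R"
    then obtain C D where R: "p_frame_with_bounds scl nnorm p a I R C D"
      by (auto simp: p_frame_def)
    then have CD: "C > 0" "D > 0"
      by (auto simp: p_frame_with_bounds_def)
    \<comment> \<open>The sum \<open>D / A + B / C\<close> dominates both comparison constants.\<close>
    define M where "M = 2 powr p * (1 + (D / A + B / C))"
    have "M > 0"
      using AB CD by (simp add: M_def add_pos_pos)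
    moreover have "?d x \<le> ennreal M * min (?t x) (?r x)" for x
    proof -
      have "?d x \<le> ennreal (2 powr p * (1 + D / A)) * ?t x"
        using p AB CD p_frame_p_sums_comparable[OF R T]
        by (intro p_sum_diff_le_of_comparable) auto
      also have "\<dots> \<le> ennreal M * ?t x"
        using AB CD unfolding M_def by (intro mult_right_mono ennreal_leI mult_left_mono) auto
      finally have t: "?d x \<le> ennreal M * ?t x" .
      have "?d x = p_sum p I (\<lambda>i. R i (x # a) - T i (x # a))"
        by (rule p_sum_minus_commute)
      also have "\<dots> \<le> ennreal (2 powr p * (1 + B / C)) * ?r x"
        using p AB CD p_frame_p_sums_comparable[OF T R]
        by (intro p_sum_diff_le_of_comparable) auto
      also have "\<dots> \<le> ennreal M * ?r x"
        using AB CD unfolding M_def by (intro mult_right_mono ennreal_leI mult_left_mono) auto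
      finally show ?thesis
        using t by (simp add: min_def)
    qed
    ultimately show "\<exists>M>0. \<forall>x. ?d x \<le> ennreal M * min (?t x) (?r x)"
      by blast
  next
    assume "\<exists>M>0. \<forall>x. ?d x \<le> ennreal M * min (?t x) (?r x)"
    then obtain M where M: "M > 0" and d: "\<And>x. ?d x \<le> ennreal M * min (?t x) (?r x)"
      by blast
    have dt: "?d x \<le> ennreal M * ?t x" and dr: "?d x \<le> ennreal M * ?r x" for x
      by (rule order_trans[OF d], rule mult_left_mono, simp_all)+
    define K where "K = 2 powr p * (1 + M)"
    have "?t x \<le> ennreal K * ?r x" for x
      unfolding K_def using p M dr by (intro p_sum_comparable_of_diff_le) auto
    moreover have "?r x \<le> ennreal K * ?t x" for x
      unfolding K_def using p M dt[of x]
      by (intro p_sum_comparable_of_diff_le) (auto simp: p_sum_minus_commute[of p I "\<lambda>i. R i (x # a)"])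
    moreover have "K > 0"
      using M by (simp add: K_def)
    ultimately have "p_frame_with_bounds scl nnorm p a I R (A / K) (K * B)"
      using T assms(7) by (intro p_frame_of_comparable) auto
    then show "p_frame scl nnorm p a I R"
      by (auto simp: p_frame_def)
  }
qed

end
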